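(* Let $L$ be a free Lie algebra of rank greater than $2$ over a field $K$ of characteristic zero. Then the ring of integers $\langle\mathbb Z;+,\times,0,1\rangle$ is e-interpretable in $L$.
   Context: A subset $X\subseteq L^m$ is e-definable (Diophantine) in $L$ if there is a finite system of equations $\Sigma(x_1,\dots,x_m,y_1,\dots,y_k)$ with coefficients in $L$ such that $(c_1,\dots,c_m)\in X$ iff $\Sigma(c_1,\dots,c_m,y_1,\dots,y_k)$ has a solution in $L$. A map $\phi:X\subseteq L^m\to\mathcal A$ onto an algebraic structure $\mathcal A$ is an e-interpretation of $\mathcal A$ in $L$ if $X$ is e-definable in $L$, and the preimages under $\phi$ of the equality relation and of the graphs of all functions, constants and predicates of $\mathcal A$ are e-definable in $L$. *)

theory Defs
  imports Complex_Main
begin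

locale lie_algebra = vector_space scale
  for scale :: "'k::field \<Rightarrow> 'l::ab_group_add \<Rightarrow> 'l" +
  fixes br :: "'l \<Rightarrow> 'l \<Rightarrow> 'l"
  assumes br_add_left: "br (x + y) z = br x z + br y z"
    and br_add_right: "br x (y + z) = br x y + br x z"
    and br_scale_left: "br (scale a x) y = scale a (br x y)"
    and br_scale_right: "br x (scale a y) = scale a (br x y)"
    and br_self: "br x x = 0"
    and jacobi: "br x (br y z) + br y (br z x) + br z (br x y) = 0"

text \<open>Terms in the language of Lie algebras over \<open>'k\<close>; a negative \<open>-t\<close> is \<open>Scale (-1) t\<close>.\<close>

datatype (dead 'k, lie_gens: 'v) lie_term =
    Gen 'v
  | Zero
  | Add "('k, 'v) lie_term" "('k, 'v) lie_term"
  | Scale 'k "('k, 'v) lie_term"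
  | Br "('k, 'v) lie_term" "('k, 'v) lie_term"

primrec lie_eval ::
    "('k \<Rightarrow> 'l \<Rightarrow> 'l) \<Rightarrow> ('l \<Rightarrow> 'l \<Rightarrow> 'l) \<Rightarrow> ('v \<Rightarrow> 'l) \<Rightarrow> ('k, 'v) lie_term \<Rightarrow> 'l::ab_group_add"
  where
    "lie_eval scale br \<rho> (Gen v) = \<rho> v"
  | "lie_eval scale br \<rho> Zero = 0"
  | "lie_eval scale br \<rho> (Add s t) = lie_eval scale br \<rho> s + lie_eval scale br \<rho> t"
  | "lie_eval scale br \<rho> (Scale a t) = scale a (lie_eval scale br \<rho> t)"
  | "lie_eval scale br \<rho> (Br s t) = br (lie_eval scale br \<rho> s) (lie_eval scale br \<rho> t)"

text \<open>
  The least congruence on terms containing the axioms of Lie algebras. The terms over \<open>X\<close> modulo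
  this congruence are the free Lie algebra on \<open>X\<close>.
\<close>

inductive lie_cong :: "('k::field, 'v) lie_term \<Rightarrow> ('k, 'v) lie_term \<Rightarrow> bool" where
  refl: "lie_cong t t"
| sym: "lie_cong s t \<Longrightarrow> lie_cong t s"
| trans: "lie_cong s t \<Longrightarrow> lie_cong t u \<Longrightarrow> lie_cong s u"
| cong_Add: "lie_cong s s' \<Longrightarrow> lie_cong t t' \<Longrightarrow> lie_cong (Add s t) (Add s' t')"
| cong_Scale: "lie_cong t t' \<Longrightarrow> lie_cong (Scale a t) (Scale a t')"
| cong_Br: "lie_cong s s' \<Longrightarrow> lie_cong t t' \<Longrightarrow> lie_cong (Br s t) (Br s' t')"
| Add_assoc: "lie_cong (Add (Add s t) u) (Add s (Add t u))"
| Add_commute: "lie_cong (Add s t) (Add t s)"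
| Add_Zero: "lie_cong (Add Zero t) t"
| Add_minus: "lie_cong (Add t (Scale (-1) t)) Zero"
| Scale_Add: "lie_cong (Scale a (Add s t)) (Add (Scale a s) (Scale a t))"
| Scale_plus: "lie_cong (Scale (a + b) t) (Add (Scale a t) (Scale b t))"
| Scale_Scale: "lie_cong (Scale a (Scale b t)) (Scale (a * b) t)"
| Scale_one: "lie_cong (Scale 1 t) t"
| Br_Add_left: "lie_cong (Br (Add s t) u) (Add (Br s u) (Br t u))"
| Br_Add_right: "lie_cong (Br s (Add t u)) (Add (Br s t) (Br s u))"
| Br_Scale_left: "lie_cong (Br (Scale a s) t) (Scale a (Br s t))"
| Br_Scale_right: "lie_cong (Br s (Scale a t)) (Scale a (Br s t))"
| Br_self: "lie_cong (Br t t) Zero"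
| Jacobi: "lie_cong (Add (Add (Br s (Br t u)) (Br t (Br u s))) (Br u (Br s t))) Zero"

text \<open>
  \<open>X\<close> is a free basis of the Lie algebra: the canonical homomorphism from the free Lie algebra on
  \<open>X\<close> (terms modulo \<^const>\<open>lie_cong\<close>), which sends each generator to itself, is bijective. HOL cannot
  quantify over all target types in a definition; the universal property, for targets of an
  arbitrary type, is derived in \<open>free_lie_algebra_universal\<close>.
\<close>

definition free_lie_algebra ::
    "('k::field \<Rightarrow> 'l::ab_group_add \<Rightarrow> 'l) \<Rightarrow> ('l \<Rightarrow> 'l \<Rightarrow> 'l) \<Rightarrow> 'l set \<Rightarrow> bool"
  where
    "free_lie_algebra scale br X \<longleftrightarrow>
       lie_algebra scale br \<and>
       (\<forall>u. \<exists>t. lie_gens t \<subseteq> X \<and> lie_eval scale br id t = u) \<and>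
       (\<forall>s t. lie_gens s \<subseteq> X \<longrightarrow> lie_gens t \<subseteq> X \<longrightarrow>
          lie_eval scale br id s = lie_eval scale br id t \<longrightarrow> lie_cong s t)"

definition lie_hom ::
    "('k \<Rightarrow> 'l::ab_group_add \<Rightarrow> 'l) \<Rightarrow> ('l \<Rightarrow> 'l \<Rightarrow> 'l) \<Rightarrow>
     ('k \<Rightarrow> 'm::ab_group_add \<Rightarrow> 'm) \<Rightarrow> ('m \<Rightarrow> 'm \<Rightarrow> 'm) \<Rightarrow> ('l \<Rightarrow> 'm) \<Rightarrow> bool"
  where
    "lie_hom scale br scale' br' h \<longleftrightarrow>
       (\<forall>x y. h (x + y) = h x + h y) \<and>
       (\<forall>a x. h (scale a x) = scale' a (h x)) \<and>
       (\<forall>x y. h (br x y) = br' (h x) (h y))"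

lemma lie_cong_sound:
  assumes "lie_cong s t" "lie_algebra scale br"
  shows "lie_eval scale br \<rho> s = lie_eval scale br \<rho> t"
proof -
  interpret lie_algebra scale br by fact
  show ?thesis
    using assms(1)
    by (induction rule: lie_cong.induct)
      (simp_all add: algebra_simps scale_right_distrib scale_left_distrib br_add_left br_add_right
        br_scale_left br_scale_right br_self jacobi[simplified algebra_simps])
qed

lemma lie_hom_eval:
  assumes "lie_hom scale br scale' br' h"
  shows "h (lie_eval scale br \<rho> t) = lie_eval scale' br' (\<lambda>v. h (\<rho> v)) t"
proof -
  have "h (0 + 0) = h 0 + h 0"
    using assms unfolding lie_hom_def by blast
  then have "h 0 = 0" by simp
  then show ?thesis
    using assms by (induction t) (auto simp: lie_hom_def)
qed

lemma lie_eval_cong: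
  "(\<And>v. v \<in> lie_gens t \<Longrightarrow> \<rho> v = \<sigma> v) \<Longrightarrow> lie_eval scale br \<rho> t = lie_eval scale br \<sigma> t"
  by (induction t) auto

theorem free_lie_algebra_universal:
  fixes scale :: "'k::field \<Rightarrow> 'l::ab_group_add \<Rightarrow> 'l"
    and scale' :: "'k \<Rightarrow> 'm::ab_group_add \<Rightarrow> 'm"
    and f :: "'l \<Rightarrow> 'm"
  assumes free: "free_lie_algebra scale br X" and M: "lie_algebra scale' br'"
  shows "\<exists>!h. lie_hom scale br scale' br' h \<and> (\<forall>x\<in>X. h x = f x)"
proof -
  let ?ev = "lie_eval scale br id" and ?ev' = "lie_eval scale' br' f"
  define term_of where "term_of u = (SOME t. lie_gens t \<subseteq> X \<and> ?ev t = u)" for u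
  have "\<exists>t. lie_gens t \<subseteq> X \<and> ?ev t = u" for u
    using free unfolding free_lie_algebra_def by blast
  then have tm: "lie_gens (term_of u) \<subseteq> X \<and> ?ev (term_of u) = u" for u
    unfolding term_of_def by (rule someI_ex)
  define h where "h u = ?ev' (term_of u)" for u
  have h: "h (?ev t) = ?ev' t" if "lie_gens t \<subseteq> X" for t
    unfolding h_def using free that tm[of "?ev t"]
    by (intro lie_cong_sound[OF _ M]) (auto simp: free_lie_algebra_def)
  have "lie_hom scale br scale' br' h"
    unfolding lie_hom_def
  proof (intro conjI allI)
    fix x y a
    show "h (x + y) = h x + h y"
      using h[of "Add (term_of x) (term_of y)"] tm[of x] tm[of y] by (simp add: h_def)
    show "h (scale a x) = scale' a (h x)"
      using h[of "Scale a (term_of x)"] tm[of x] by (simp add: h_def)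
    show "h (br x y) = br' (h x) (h y)"
      using h[of "Br (term_of x) (term_of y)"] tm[of x] tm[of y] by (simp add: h_def)
  qed
  moreover have "h x = f x" if "x \<in> X" for x
    using h[of "Gen x"] that by simp
  moreover have "g = h" if "lie_hom scale br scale' br' g" "\<forall>x\<in>X. g x = f x" for g
  proof
    fix u
    have "g u = lie_eval scale' br' (\<lambda>v. g v) (term_of u)"
      using lie_hom_eval[OF that(1), of id "term_of u"] tm[of u] by simp
    also have "\<dots> = h u"
      unfolding h_def using tm[of u] that(2) by (intro lie_eval_cong) auto
    finally show "g u = h u" .
  qed
  ultimately show ?thesis by blast
qed

text \<open>
  Equations with coefficients in \<open>L\<close> are pairs of terms built from unknowns, numbered from \<open>0\<close>, and
  constants from \<open>L\<close>. Tuples are lists.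
\<close>

datatype 'l eq_symbol = Unknown nat | Coeff 'l

type_synonym ('k, 'l) lie_equation =
  "('k, 'l eq_symbol) lie_term \<times> ('k, 'l eq_symbol) lie_term"

primrec eq_assign :: "'l list \<Rightarrow> 'l eq_symbol \<Rightarrow> 'l" where
  "eq_assign zs (Unknown i) = zs ! i"
| "eq_assign zs (Coeff c) = c"

definition eq_unknowns :: "('k, 'l) lie_equation \<Rightarrow> nat set" where
  "eq_unknowns e = {i. Unknown i \<in> lie_gens (fst e) \<union> lie_gens (snd e)}"

definition eq_solution ::
    "('k \<Rightarrow> 'l::ab_group_add \<Rightarrow> 'l) \<Rightarrow> ('l \<Rightarrow> 'l \<Rightarrow> 'l) \<Rightarrow> 'l list \<Rightarrow> ('k, 'l) lie_equation \<Rightarrow> bool"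
  where
    "eq_solution scale br zs e \<longleftrightarrow>
       lie_eval scale br (eq_assign zs) (fst e) = lie_eval scale br (eq_assign zs) (snd e)"

definition e_definable ::
    "('k \<Rightarrow> 'l::ab_group_add \<Rightarrow> 'l) \<Rightarrow> ('l \<Rightarrow> 'l \<Rightarrow> 'l) \<Rightarrow> nat \<Rightarrow> 'l list set \<Rightarrow> bool"
  where
    "e_definable scale br m X \<longleftrightarrow>
       (\<exists>k (\<Sigma> :: ('k, 'l) lie_equation set).
          finite \<Sigma> \<and> (\<forall>e\<in>\<Sigma>. eq_unknowns e \<subseteq> {..<m + k}) \<and>
          X = {xs. length xs = m \<and>
                (\<exists>ys. length ys = k \<and> (\<forall>e\<in>\<Sigma>. eq_solution scale br (xs @ ys) e))})"

text \<open>Operations and predicates are paired with their arities.\<close>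

record 'a alg_structure =
  universe :: "'a set"
  operations :: "(nat \<times> ('a list \<Rightarrow> 'a)) set"
  constants :: "'a set"
  predicates :: "(nat \<times> 'a list set) set"

text \<open>
  The preimage under \<open>\<phi>\<close> of an \<open>n\<close>-ary relation \<open>R\<close>, as a set of \<open>n * m\<close>-tuples when \<open>X\<close> is a set
  of \<open>m\<close>-tuples.
\<close>

definition rel_preimage ::
    "'l list set \<Rightarrow> ('l list \<Rightarrow> 'a) \<Rightarrow> nat \<Rightarrow> 'a list set \<Rightarrow> 'l list set" where
  "rel_preimage X \<phi> n R =
     {concat xss | xss. length xss = n \<and> set xss \<subseteq> X \<and> map \<phi> xss \<in> R}"

definition e_interpretation ::
    "('k \<Rightarrow> 'l::ab_group_add \<Rightarrow> 'l) \<Rightarrow> ('l \<Rightarrow> 'l \<Rightarrow> 'l) \<Rightarrow> 'a alg_structure \<Rightarrow>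
     nat \<Rightarrow> 'l list set \<Rightarrow> ('l list \<Rightarrow> 'a) \<Rightarrow> bool"
  where
    "e_interpretation scale br A m X \<phi> \<longleftrightarrow>
       e_definable scale br m X \<and>
       \<phi> ` X = universe A \<and>
       e_definable scale br (2 * m) (rel_preimage X \<phi> 2 {[a, a] | a. a \<in> universe A}) \<and>
       (\<forall>(n, f) \<in> operations A.
          e_definable scale br ((n + 1) * m)
            (rel_preimage X \<phi> (n + 1)
              {as @ [f as] | as. length as = n \<and> set as \<subseteq> universe A})) \<and>
       (\<forall>c \<in> constants A. e_definable scale br m (rel_preimage X \<phi> 1 {[c]})) \<and>
       (\<forall>(n, R) \<in> predicates A. e_definable scale br (n * m) (rel_preimage X \<phi> n R))"

definition e_interpretable ::
    "('k \<Rightarrow> 'l::ab_group_add \<Rightarrow> 'l) \<Rightarrow> ('l \<Rightarrow> 'l \<Rightarrow> 'l) \<Rightarrow> 'a alg_structure \<Rightarrow> bool"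
  where
    "e_interpretable scale br A \<longleftrightarrow> (\<exists>m X \<phi>. e_interpretation scale br A m X \<phi>)"

definition int_ring :: "int alg_structure" where
  "int_ring =
     \<lparr> universe = UNIV,
       operations = {(2, \<lambda>as. as ! 0 + as ! 1), (2, \<lambda>as. as ! 0 * as ! 1)},
       constants = {0, 1},
       predicates = {} \<rparr>"

end

theory Submission
  imports Defs "HOL-Library.Product_Plus" "HOL-Computational_Algebra.Polynomial"
begin

text \<open>
  Let \<open>x, y, w\<close> be three free generators. The centralizer of \<open>x\<close> is \<open>K x\<close>, so the scalars are encoded
  by the \<open>z\<close> with \<open>[z, x] = 0\<close>. The elements \<open>y f(ad x)\<close>, with \<open>ad x\<close> acting from the right, stand
  for the polynomials \<open>f\<close>, and the part of the algebra that is linear in both \<open>y\<close> and \<open>w\<close> for the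
  polynomials in \<open>s, t\<close>: \<open>[y f(ad x), w g(ad x)]\<close> is \<open>f(s) g(t)\<close>, and bracketing with \<open>x\<close> is
  multiplication by \<open>s + t\<close>. The equation \<open>[p, w] = [y, q] + [[r, w] + [v, x], x]\<close> therefore
  reads \<open>p(s) = q(t) + (s + t) r(s) + (s + t)\<^sup>2 v(s, t)\<close>, which forces \<open>r = p'\<close>. For \<open>z = c x\<close> the
  equation \<open>[z, p] = [x, [r, x]]\<close> adds \<open>s p' = c p\<close>, and \<open>p + g = y + [g, x]\<close> says \<open>p(1) = 1\<close>. In
  characteristic zero the system is solvable exactly when \<open>c\<close> is a natural number, with
  \<open>p = s^c\<close>. Sums of scalars are sums in the algebra, and products are expressed by brackets.
\<close>

section \<open>Closure properties of e-definable sets\<close>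

primrec lie_subst :: "('v \<Rightarrow> ('k, 'w) lie_term) \<Rightarrow> ('k, 'v) lie_term \<Rightarrow> ('k, 'w) lie_term" where
  "lie_subst \<sigma> (Gen v) = \<sigma> v"
| "lie_subst \<sigma> Zero = Zero"
| "lie_subst \<sigma> (Add s t) = Add (lie_subst \<sigma> s) (lie_subst \<sigma> t)"
| "lie_subst \<sigma> (Scale a t) = Scale a (lie_subst \<sigma> t)"
| "lie_subst \<sigma> (Br s t) = Br (lie_subst \<sigma> s) (lie_subst \<sigma> t)"

lemma lie_eval_subst:
  "lie_eval scale br \<rho> (lie_subst \<sigma> t) = lie_eval scale br (\<lambda>v. lie_eval scale br \<rho> (\<sigma> v)) t"
  by (induction t) auto

lemma lie_gens_subst: "lie_gens (lie_subst \<sigma> t) = (\<Union>v\<in>lie_gens t. lie_gens (\<sigma> v))"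
  by (induction t) auto

fun eq_subst ::
    "(nat \<Rightarrow> ('k, 'l eq_symbol) lie_term) \<Rightarrow> ('k, 'l) lie_equation \<Rightarrow> ('k, 'l) lie_equation" where
  "eq_subst \<tau> (s, t) =
     (lie_subst (case_eq_symbol \<tau> (\<lambda>c. Gen (Coeff c))) s,
      lie_subst (case_eq_symbol \<tau> (\<lambda>c. Gen (Coeff c))) t)"

lemma eq_unknowns_subst:
  assumes "eq_unknowns e \<subseteq> I" "\<And>i j. i \<in> I \<Longrightarrow> Unknown j \<in> lie_gens (\<tau> i) \<Longrightarrow> j \<in> J"
  shows "eq_unknowns (eq_subst \<tau> e) \<subseteq> J"
proof
  fix j assume "j \<in> eq_unknowns (eq_subst \<tau> e)"
  then obtain v where v: "v \<in> lie_gens (fst e) \<union> lie_gens (snd e)"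
    "Unknown j \<in> lie_gens (case_eq_symbol \<tau> (\<lambda>c. Gen (Coeff c)) v)"
    by (cases e) (auto simp: eq_unknowns_def lie_gens_subst)
  then obtain i where "v = Unknown i" "Unknown j \<in> lie_gens (\<tau> i)"
    by (cases v rule: eq_symbol.exhaust) auto
  with v(1) show "j \<in> J"
    using assms by (auto simp: eq_unknowns_def)
qed

lemma eq_solution_subst:
  assumes "eq_unknowns e \<subseteq> I"
    and "\<And>i. i \<in> I \<Longrightarrow> lie_eval scale br (eq_assign zs) (\<tau> i) = us ! i"
  shows "eq_solution scale br zs (eq_subst \<tau> e) \<longleftrightarrow> eq_solution scale br us e"
proof -
  let ?\<sigma> = "case_eq_symbol \<tau> (\<lambda>c. Gen (Coeff c))"
  have "lie_eval scale br (eq_assign zs) (lie_subst ?\<sigma> t) = lie_eval scale br (eq_assign us) t"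
    if "t = fst e \<or> t = snd e" for t
    unfolding lie_eval_subst
  proof (rule lie_eval_cong)
    fix v assume "v \<in> lie_gens t"
    then show "lie_eval scale br (eq_assign zs) (?\<sigma> v) = eq_assign us v"
      using that assms unfolding eq_unknowns_def by (cases v rule: eq_symbol.exhaust) auto
  qed
  then show ?thesis
    unfolding eq_solution_def by (cases e) simp
qed

lemma e_definableI:
  fixes \<Sigma> :: "('k, 'l::ab_group_add) lie_equation set"
  assumes "finite \<Sigma>" "\<And>e. e \<in> \<Sigma> \<Longrightarrow> eq_unknowns e \<subseteq> {..<m + k}"
    and "\<And>xs. xs \<in> X \<longleftrightarrow> length xs = m \<and>
      (\<exists>ys. length ys = k \<and> (\<forall>e\<in>\<Sigma>. eq_solution scale br (xs @ ys) e))"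
  shows "e_definable scale br m X"
  unfolding e_definable_def using assms by (intro exI[of _ k] exI[of _ \<Sigma>]) auto

lemma e_definable_equation:
  assumes "eq_unknowns e \<subseteq> {..<m}"
  shows "e_definable scale br m {xs. length xs = m \<and> eq_solution scale br xs e}"
  by (rule e_definableI[where k = 0 and \<Sigma> = "{e}"]) (use assms in simp_all)

text \<open>Substituting \<open>ts\<close> for the first \<open>n\<close> unknowns turns a system
  for \<open>X\<close> into one for its preimage under the term map; the auxiliary unknowns are
  kept, but renumbered.\<close>

lemma e_definable_subst:
  assumes "e_definable scale br n X" and len: "length ts = n"
    and ts: "\<And>t j. t \<in> set ts \<Longrightarrow> Unknown j \<in> lie_gens t \<Longrightarrow> j < m"
  shows "e_definable scale br m
    {xs. length xs = m \<and> map (lie_eval scale br (eq_assign xs)) ts \<in> X}"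
proof -
  obtain k \<Sigma> where \<Sigma>: "finite \<Sigma>" "\<forall>e\<in>\<Sigma>. eq_unknowns e \<subseteq> {..<n + k}"
    and X: "X = {xs. length xs = n \<and>
      (\<exists>ys. length ys = k \<and> (\<forall>e\<in>\<Sigma>. eq_solution scale br (xs @ ys) e))}"
    using assms(1) unfolding e_definable_def by blast
  \<comment> \<open>Auxiliary unknowns start at \<open>n\<close> in the old system and at
    \<open>m\<close> in the new one.\<close>
  define \<tau> where "\<tau> i = (if i < n then ts ! i else Gen (Unknown (m + (i - n))))" for i
  have eval: "lie_eval scale br (eq_assign (xs @ ys)) t = lie_eval scale br (eq_assign xs) t"
    if "length xs = m" "t \<in> set ts" for xs ys t
  proof (rule lie_eval_cong)
    fix v assume "v \<in> lie_gens t"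
    then show "eq_assign (xs @ ys) v = eq_assign xs v"
      using ts[OF that(2)] that(1) by (cases v rule: eq_symbol.exhaust) (simp_all add: nth_append)
  qed
  have sol: "eq_solution scale br (xs @ ys) (eq_subst \<tau> e) \<longleftrightarrow>
      eq_solution scale br (map (lie_eval scale br (eq_assign xs)) ts @ ys) e"
    if "length xs = m" "length ys = k" "e \<in> \<Sigma>" for xs ys e
  proof (rule eq_solution_subst[where I = "{..<n + k}"])
    show "eq_unknowns e \<subseteq> {..<n + k}" using \<Sigma>(2) that(3) by blast
    show "lie_eval scale br (eq_assign (xs @ ys)) (\<tau> i) =
        (map (lie_eval scale br (eq_assign xs)) ts @ ys) ! i" for i
    proof (cases "i < n")
      case True
      then have "ts ! i \<in> set ts" using len by simp
      from eval[OF that(1) this, of ys] show ?thesis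
        using True len by (simp add: \<tau>_def nth_append)
    next
      case False
      then obtain j where "i = n + j" by (metis le_iff_add not_less)
      then show ?thesis
        using that(1) len by (simp add: \<tau>_def nth_append)
    qed
  qed
  show ?thesis
  proof (rule e_definableI[where \<Sigma> = "eq_subst \<tau> ` \<Sigma>" and k = k])
    show "eq_unknowns e \<subseteq> {..<m + k}" if "e \<in> eq_subst \<tau> ` \<Sigma>" for e
    proof (use that in \<open>elim imageE\<close>)
      fix d assume d: "e = eq_subst \<tau> d" "d \<in> \<Sigma>"
      have "j < m + k" if "i < n + k" "Unknown j \<in> lie_gens (\<tau> i)" for i j
      proof (cases "i < n")
        case True
        then have "ts ! i \<in> set ts" using len by simp
        from ts[OF this, of j] show ?thesis
          using True that(2) by (simp add: \<tau>_def)
      next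
        case False
        then obtain i' where "i = n + i'" by (metis le_iff_add not_less)
        with that show ?thesis by (simp add: \<tau>_def)
      qed
      moreover have "eq_unknowns d \<subseteq> {..<n + k}" using d(2) \<Sigma>(2) by blast
      ultimately show ?thesis
        unfolding d(1) by (intro eq_unknowns_subst[where I = "{..<n + k}"]) auto
    qed
    show "xs \<in> {xs. length xs = m \<and> map (lie_eval scale br (eq_assign xs)) ts \<in> X} \<longleftrightarrow>
        length xs = m \<and>
        (\<exists>ys. length ys = k \<and> (\<forall>e\<in>eq_subst \<tau> ` \<Sigma>. eq_solution scale br (xs @ ys) e))" for xs
      unfolding X mem_Collect_eq length_map len ball_simps using sol by blast
  qed (use \<Sigma>(1) in blast)
qed

lemma e_definable_Int:
  assumes "e_definable scale br m X" "e_definable scale br m Y"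
  shows "e_definable scale br m (X \<inter> Y)"
proof -
  obtain k \<Sigma> where \<Sigma>: "finite \<Sigma>" "\<forall>e\<in>\<Sigma>. eq_unknowns e \<subseteq> {..<m + k}"
    and X: "X = {xs. length xs = m \<and>
      (\<exists>ys. length ys = k \<and> (\<forall>e\<in>\<Sigma>. eq_solution scale br (xs @ ys) e))}"
    using assms(1) unfolding e_definable_def by blast
  obtain l \<Delta> where \<Delta>: "finite \<Delta>" "\<forall>e\<in>\<Delta>. eq_unknowns e \<subseteq> {..<m + l}"
    and Y: "Y = {xs. length xs = m \<and>
      (\<exists>ys. length ys = l \<and> (\<forall>e\<in>\<Delta>. eq_solution scale br (xs @ ys) e))}"
    using assms(2) unfolding e_definable_def by blast
  \<comment> \<open>The two systems must not share auxiliary unknowns, so those of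
    \<open>\<Delta>\<close> move up by \<open>k\<close>, past those of
    \<open>\<Sigma>\<close>.\<close>
  define \<tau> :: "nat \<Rightarrow> ('a, 'b eq_symbol) lie_term"
    where "\<tau> i = Gen (Unknown (if i < m then i else i + k))" for i
  define \<upsilon> :: "nat \<Rightarrow> ('a, 'b eq_symbol) lie_term"
    where "\<upsilon> i = Gen (Unknown i)" for i
  have sol1: "eq_solution scale br (xs @ ys @ zs) (eq_subst \<upsilon> e) \<longleftrightarrow> eq_solution scale br (xs @ ys) e"
    if "length xs = m" "length ys = k" "e \<in> \<Sigma>" for xs ys zs e
    by (rule eq_solution_subst[where I = "{..<m + k}"])
      (use that \<Sigma> in \<open>auto simp: \<upsilon>_def nth_append\<close>)
  have sol2: "eq_solution scale br (xs @ ys @ zs) (eq_subst \<tau> e) \<longleftrightarrow> eq_solution scale br (xs @ zs) e"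
    if "length xs = m" "length ys = k" "length zs = l" "e \<in> \<Delta>" for xs ys zs e
    by (rule eq_solution_subst[where I = "{..<m + l}"])
      (use that \<Delta> in \<open>auto simp: \<tau>_def nth_append\<close>)
  show ?thesis
  proof (rule e_definableI[where \<Sigma> = "eq_subst \<upsilon> ` \<Sigma> \<union> eq_subst \<tau> ` \<Delta>" and k = "k + l"])
    show "eq_unknowns e \<subseteq> {..<m + (k + l)}" if "e \<in> eq_subst \<upsilon> ` \<Sigma> \<union> eq_subst \<tau> ` \<Delta>" for e
    proof (use that in \<open>elim UnE imageE\<close>)
      fix d assume "e = eq_subst \<upsilon> d" "d \<in> \<Sigma>"
      then show ?thesis
        using \<Sigma>(2) by (simp only:) (rule eq_unknowns_subst[where I = "{..<m + k}"], auto simp: \<upsilon>_def)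
    next
      fix d assume "e = eq_subst \<tau> d" "d \<in> \<Delta>"
      then show ?thesis
        using \<Delta>(2)
        by (simp only:) (rule eq_unknowns_subst[where I = "{..<m + l}"], auto simp: \<tau>_def split: if_splits)
    qed
    fix xs
    show "xs \<in> X \<inter> Y \<longleftrightarrow> length xs = m \<and> (\<exists>ys. length ys = k + l \<and>
        (\<forall>e\<in>eq_subst \<upsilon> ` \<Sigma> \<union> eq_subst \<tau> ` \<Delta>. eq_solution scale br (xs @ ys) e))"
    proof
      assume "xs \<in> X \<inter> Y"
      then obtain ys zs where *: "length xs = m" "length ys = k" "length zs = l"
        "\<forall>e\<in>\<Sigma>. eq_solution scale br (xs @ ys) e" "\<forall>e\<in>\<Delta>. eq_solution scale br (xs @ zs) e"
        unfolding X Y by blast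
      have "\<forall>e\<in>eq_subst \<upsilon> ` \<Sigma> \<union> eq_subst \<tau> ` \<Delta>. eq_solution scale br (xs @ ys @ zs) e"
        using sol1[OF *(1,2)] sol2[OF *(1-3)] *(4,5) by blast
      then show "length xs = m \<and> (\<exists>ys. length ys = k + l \<and>
        (\<forall>e\<in>eq_subst \<upsilon> ` \<Sigma> \<union> eq_subst \<tau> ` \<Delta>. eq_solution scale br (xs @ ys) e))"
        using *(1-3) by (intro conjI exI[of _ "ys @ zs"]) simp_all
    next
      assume "length xs = m \<and> (\<exists>ys. length ys = k + l \<and>
        (\<forall>e\<in>eq_subst \<upsilon> ` \<Sigma> \<union> eq_subst \<tau> ` \<Delta>. eq_solution scale br (xs @ ys) e))"
      then obtain us where us: "length xs = m" "length us = k + l"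
        "\<forall>e\<in>eq_subst \<upsilon> ` \<Sigma> \<union> eq_subst \<tau> ` \<Delta>. eq_solution scale br (xs @ us) e" by blast
      obtain ys zs where yz: "us = ys @ zs" "length ys = k" "length zs = l"
        using us(2) by (metis append_take_drop_id length_drop length_take min.absorb2 le_add1 add_diff_cancel_left')
      have "\<forall>e\<in>\<Sigma>. eq_solution scale br (xs @ ys) e" "\<forall>e\<in>\<Delta>. eq_solution scale br (xs @ zs) e"
        using us(3) sol1[OF us(1) yz(2)] sol2[OF us(1) yz(2,3)] unfolding yz(1) by blast+
      then show "xs \<in> X \<inter> Y"
        unfolding X Y using us(1) yz by blast
    qed
  qed (use \<Sigma>(1) \<Delta>(1) in auto)
qed

text \<open>The system stays the same: the quantified coordinates are merely recounted as auxiliary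
  unknowns.\<close>

lemma e_definable_exists:
  assumes "e_definable scale br (m + k) X"
  shows "e_definable scale br m {xs. length xs = m \<and> (\<exists>ys. length ys = k \<and> xs @ ys \<in> X)}"
proof -
  obtain l \<Sigma> where \<Sigma>: "finite \<Sigma>" "\<forall>e\<in>\<Sigma>. eq_unknowns e \<subseteq> {..<m + k + l}"
    and X: "X = {xs. length xs = m + k \<and>
      (\<exists>ys. length ys = l \<and> (\<forall>e\<in>\<Sigma>. eq_solution scale br (xs @ ys) e))}"
    using assms(1) unfolding e_definable_def by blast
  show ?thesis
  proof (rule e_definableI[where \<Sigma> = \<Sigma> and k = "k + l"])
    fix xs
    show "xs \<in> {xs. length xs = m \<and> (\<exists>ys. length ys = k \<and> xs @ ys \<in> X)} \<longleftrightarrow> length xs = m \<and>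
        (\<exists>ys. length ys = k + l \<and> (\<forall>e\<in>\<Sigma>. eq_solution scale br (xs @ ys) e))"
    proof
      assume "length xs = m \<and> (\<exists>ys. length ys = k + l \<and> (\<forall>e\<in>\<Sigma>. eq_solution scale br (xs @ ys) e))"
      then obtain ys where ys: "length xs = m" "length ys = k + l"
        "\<forall>e\<in>\<Sigma>. eq_solution scale br (xs @ ys) e" by blast
      then have "xs @ take k ys \<in> X"
        unfolding X by (auto intro!: exI[of _ "drop k ys"])
      then show "xs \<in> {xs. length xs = m \<and> (\<exists>ys. length ys = k \<and> xs @ ys \<in> X)}"
        using ys by (auto intro!: exI[of _ "take k ys"])
    next
      assume "xs \<in> {xs. length xs = m \<and> (\<exists>ys. length ys = k \<and> xs @ ys \<in> X)}"
      then obtain ys zs where "length xs = m" "length ys = k" "length zs = l"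
        "\<forall>e\<in>\<Sigma>. eq_solution scale br (xs @ ys @ zs) e" unfolding X by auto
      then show "length xs = m \<and> (\<exists>ys. length ys = k + l \<and> (\<forall>e\<in>\<Sigma>. eq_solution scale br (xs @ ys) e))"
        by (intro conjI exI[of _ "ys @ zs"]) auto
    qed
  qed (use \<Sigma> in \<open>auto simp: add.assoc\<close>)
qed

section \<open>The centralizer of a generator\<close>

context lie_algebra
begin

lemma br_zero_left [simp]: "br 0 z = 0"
  using br_add_left[of 0 0 z] by simp

lemma br_zero_right [simp]: "br z 0 = 0"
  using br_add_right[of z 0 0] by simp

lemma br_minus_left: "br (- u) z = - br u z"
  using br_add_left[of "- u" u z] by (simp add: eq_neg_iff_add_eq_0)

lemma br_minus_right: "br z (- u) = - br z u"
  using br_add_right[of z "- u" u] by (simp add: eq_neg_iff_add_eq_0)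

lemma br_diff_left: "br (u - v) z = br u z - br v z"
  using br_add_left[of u "- v" z] by (simp add: br_minus_left)

lemma br_diff_right: "br z (u - v) = br z u - br z v"
  using br_add_right[of z u "- v"] by (simp add: br_minus_right)

lemma br_antisym: "br u v = - br v u"
proof -
  have "br u u + br v u + (br u v + br v v) = 0"
    using br_self[of "u + v"] unfolding br_add_left br_add_right .
  then show ?thesis by (simp add: br_self eq_neg_iff_add_eq_0 add.commute)
qed

lemma br_sum_left: "br (\<Sum>i\<in>I. f i) z = (\<Sum>i\<in>I. br (f i) z)"
  by (induction I rule: infinite_finite_induct) (auto simp: br_add_left)

text \<open>Jacobi, rearranged for the right action of \<open>x\<close>. This product rule is why
  bracketing with \<open>x\<close> becomes multiplication by s + t.\<close>

lemma br_right_derivation: "br (br u v) x = br (br u x) v + br u (br v x)"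
proof -
  have "br (br u v) x = - br x (br u v)" "br (br u x) v = br v (br x u)"
    by (metis br_antisym) (metis br_antisym br_minus_right minus_minus)
  then show ?thesis
    using jacobi[of x u v] by (simp add: neg_eq_iff_add_eq_0 add_ac)
qed

text \<open>Expanding (-t)^n = (s - (s + t))^n to first order in s + t gives s^n = (-t)^n + (s + t)
  (n s^(n-1) + (s + t) v). The induction uses only bracket identities, so the expansion holds in
  every Lie algebra.\<close>

lemma br_funpow_expansion:
  fixes x :: 'l
  defines "D \<equiv> (\<lambda>z. br z x)"
  shows "\<exists>v. br ((D ^^ n) y) w =
    scale ((-1) ^ n) (br y ((D ^^ n) w)) + D (scale (of_nat n) (br ((D ^^ (n - 1)) y) w) + D v)"
proof (induction n arbitrary: y)
  case 0
  show ?case by (intro exI[of _ 0]) (simp add: D_def)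
next
  case (Suc n)
  let ?W = "(D ^^ n) w"
  have D_add: "D (a + b) = D a + D b" and D_scale: "D (scale c a) = scale c (D a)"
    and D_diff: "D (a - b) = D a - D b" for a b c
    by (simp_all add: D_def br_add_left br_scale_left br_diff_left)
  have D_funpow: "(D ^^ k) (D z) = D ((D ^^ k) z)" for k z
    by (rule funpow_swap1[symmetric])
  \<comment> \<open>The hypothesis is used twice: at \<open>D y\<close> to expand the bracket, and
    at \<open>y\<close> to trade \<open>br y ?W\<close> for \<open>br ((D ^^ n) y) w\<close> up to
    sign and modulo the image of \<open>D\<close>. This trade raises the coefficient from n to n +
    1.\<close>
  obtain v1 where v1: "br ((D ^^ n) y) w = scale ((-1) ^ n) (br y ?W) +
      D (scale (of_nat n) (br ((D ^^ (n - 1)) y) w) + D v1)"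
    using Suc by blast
  obtain v2 where v2: "br ((D ^^ n) (D y)) w = scale ((-1) ^ n) (br (D y) ?W) +
      D (scale (of_nat n) (br ((D ^^ (n - 1)) (D y)) w) + D v2)"
    using Suc by blast
  \<comment> \<open>For \<open>n = 0\<close> both sides vanish, which makes the truncated
    \<open>n - 1\<close> harmless.\<close>
  have n: "scale (of_nat n) (br ((D ^^ (n - 1)) (D y)) w) = scale (of_nat n) (br ((D ^^ n) y) w)"
    by (cases n) (simp_all add: D_funpow)
  have shift: "br (D y) ?W = D (br y ?W) - br y (D ?W)"
    using br_right_derivation[of y ?W x] by (simp add: D_def)
  have yW: "scale ((-1) ^ n) (br y ?W) = br ((D ^^ n) y) w -
      D (scale (of_nat n) (br ((D ^^ (n - 1)) y) w) + D v1)"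
    using v1 by simp
  have "br ((D ^^ Suc n) y) w = scale ((-1) ^ Suc n) (br y (D ?W)) +
      D (scale ((-1) ^ n) (br y ?W) + scale (of_nat n) (br ((D ^^ n) y) w) + D v2)"
    using v2 unfolding n shift
    by (simp add: D_funpow D_add D_scale scale_right_diff_distrib algebra_simps)
  also have "\<dots> = scale ((-1) ^ Suc n) (br y (D ?W)) +
      D (scale (of_nat (Suc n)) (br ((D ^^ n) y) w) +
        D (v2 - (scale (of_nat n) (br ((D ^^ (n - 1)) y) w) + D v1)))"
    unfolding yW by (simp add: D_add D_diff D_scale scale_left_distrib algebra_simps)
  finally show ?case by auto
qed

end

section \<open>Eigenvectors, nilpotency and the kernel of \<open>ad x\<close>\<close>

lemma free_lie_algebra_induct:
  assumes "free_lie_algebra scale br B"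
    and "\<And>b. b \<in> B \<Longrightarrow> P b" "P 0" "\<And>u v. P u \<Longrightarrow> P v \<Longrightarrow> P (u + v)"
    and "\<And>c u. P u \<Longrightarrow> P (scale c u)" "\<And>u v. P u \<Longrightarrow> P v \<Longrightarrow> P (br u v)"
  shows "P z"
proof -
  obtain t where t: "lie_gens t \<subseteq> B" "lie_eval scale br id t = z"
    using assms(1) unfolding free_lie_algebra_def by blast
  have "lie_gens t \<subseteq> B \<Longrightarrow> P (lie_eval scale br id t)" for t
    by (induction t) (auto intro: assms)
  then show ?thesis using t by blast
qed

text \<open>On the span, \<delta> is diagonalizable with eigenvalues among 1, 2, 3, ..., which are
  nonzero in characteristic zero. So \<delta> is injective there, and since it preserves the span,
  its powers are injective too.\<close>

lemma span_eigenvectors_nilpotent: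
  fixes scale :: "'k::field_char_0 \<Rightarrow> 'l::ab_group_add \<Rightarrow> 'l"
  assumes vs: "vector_space scale"
    and add: "\<And>u v. \<delta> (u + v) = \<delta> u + \<delta> v" and scl: "\<And>c u. \<delta> (scale c u) = scale c (\<delta> u)"
    and "u \<in> module.span scale {u. \<exists>n. \<delta> u = scale (of_nat (Suc n)) u}" "(\<delta> ^^ k) u = 0"
  shows "u = 0"
proof -
  interpret vector_space scale by fact
  define S where "S = {u. \<exists>n. \<delta> u = scale (of_nat (Suc n)) u}"
  have zero: "\<delta> 0 = 0" using scl[of 0 0] by simp
  \<comment> \<open>\<open>Q n\<close> is the product of the operators \<delta> - i for 1 \<le> i
    \<le> n. Each element of the span is annihilated by some \<open>Q n\<close>, while on the kernel
    of \<delta> every \<open>Q n\<close> is multiplication by a nonzero scalar.\<close>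
  define Q where "Q = rec_nat id (\<lambda>n f u. \<delta> (f u) - scale (of_nat (Suc n)) (f u))"
  have Q0: "Q 0 u = u" and QS: "Q (Suc n) u = \<delta> (Q n u) - scale (of_nat (Suc n)) (Q n u)" for n u
    by (simp_all add: Q_def)
  have Q_add: "Q n (u + v) = Q n u + Q n v" for n u v
    by (induction n) (simp_all only: Q0 QS add scale_right_distrib, simp add: algebra_simps)
  have Q_scale: "Q n (scale c u) = scale c (Q n u)" for n c u
    by (induction n) (simp_all only: Q0 QS scl scale_right_diff_distrib scale_left_commute)
  have Q_eigen: "Q n u = scale (\<Prod>i<n. e - of_nat (Suc i)) u" if "\<delta> u = scale e u" for n e u
    by (induction n) (simp_all only: Q0 QS scl that, simp_all add: scale_left_diff_distrib mult_ac algebra_simps)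
  have Q_mono: "Q m u = 0" if "Q n u = 0" "n \<le> m" for n m u
    using that(2,1) by (induction rule: dec_induct) (simp_all add: QS zero)
  have Q_ex: "\<exists>n. Q n u = 0" if "u \<in> span S" for u
    using that
  proof (induction rule: span_induct)
    case base
    show ?case
    proof (rule subspaceI)
      have "Q 0 0 = 0" by (simp add: Q0)
      then show "0 \<in> {u. \<exists>n. Q n u = 0}" by blast
    next
      fix u v assume "u \<in> {u. \<exists>n. Q n u = 0}" "v \<in> {u. \<exists>n. Q n u = 0}"
      then obtain m n where "Q m u = 0" "Q n v = 0" by blast
      then have "Q (max m n) (u + v) = 0"
        using Q_mono[of m u "max m n"] Q_mono[of n v "max m n"] by (simp add: Q_add)
      then show "u + v \<in> {u. \<exists>n. Q n u = 0}" by blast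
    next
      fix c u assume "u \<in> {u. \<exists>n. Q n u = 0}"
      then show "scale c u \<in> {u. \<exists>n. Q n u = 0}" by (auto simp: Q_scale)
    qed
  next
    case (step u)
    then obtain n where "\<delta> u = scale (of_nat (Suc n)) u" unfolding S_def by blast
    then have "Q (Suc n) u = 0" using Q_eigen[of u "of_nat (Suc n)" "Suc n"] by simp
    then show ?case by blast
  qed
  have inj: "u = 0" if "u \<in> span S" "\<delta> u = 0" for u
  proof -
    obtain n where "Q n u = 0" using Q_ex \<open>u \<in> span S\<close> by blast
    moreover have "(\<Prod>i<n. 0 - of_nat (Suc i) :: 'k) \<noteq> 0"
      by (simp del: of_nat_Suc)
    ultimately show "u = 0"
      using Q_eigen[of u 0 n] \<open>\<delta> u = 0\<close> by (metis scale_eq_0_iff scale_zero_left)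
  qed
  have \<delta>_span: "\<delta> u \<in> span S" if "u \<in> span S" for u
    using that
  proof (induction rule: span_induct)
    case base
    show ?case by (rule subspaceI) (auto simp: zero add scl span_zero span_add span_scale)
  next
    case (step u)
    then obtain n where "\<delta> u = scale (of_nat (Suc n)) u" unfolding S_def by blast
    then show ?case using span_scale[OF span_base[OF step]] by metis
  qed
  have "u \<in> span S \<Longrightarrow> (\<delta> ^^ k) u = 0 \<Longrightarrow> u = 0" for u
  proof (induction k arbitrary: u)
    case (Suc k)
    then have "\<delta> u = 0"
      using \<delta>_span by (simp add: funpow_Suc_right del: funpow.simps(2))
    then show ?case using inj Suc.prems(1) by blast
  qed simp
  then show ?thesis using assms(4,5) by (simp add: S_def)
qed

text \<open>
  \<open>\<alpha>\<close> is the coefficient of the generator \<open>x\<close>, \<open>\<delta>\<close> multiplies a monomial by its degree in the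
  other generators, and \<open>E\<close> behaves like the derivation \<open>\<partial>/\<partial>x\<close>
  for which \<open>E x\<close> acts on the algebra as \<open>\<delta>\<close>. Hence
  \<open>[E, ad x] = \<delta>\<close>. As \<open>E\<close> is locally nilpotent and commutes with \<open>\<delta>\<close>, this makes \<open>\<delta>\<close> nilpotent on
  the kernel of \<open>ad x\<close>, where it is also diagonalizable, so the kernel has \<open>\<delta>\<close>-degree zero.
\<close>

lemma free_lie_algebra_lowering_operator:
  fixes scale :: "'k::field \<Rightarrow> 'l::ab_group_add \<Rightarrow> 'l"
  assumes "free_lie_algebra scale br B"
  obtains \<alpha> :: "'l \<Rightarrow> 'k" and \<delta> E :: "'l \<Rightarrow> 'l" where
    "\<And>u v. \<alpha> (u + v) = \<alpha> u + \<alpha> v" "\<And>c u. \<alpha> (scale c u) = c * \<alpha> u" "\<And>u v. \<alpha> (br u v) = 0"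
    "\<And>u v. \<delta> (u + v) = \<delta> u + \<delta> v" "\<And>c u. \<delta> (scale c u) = scale c (\<delta> u)"
    "\<And>u v. \<delta> (br u v) = br (\<delta> u) v + br u (\<delta> v)"
    "\<And>u v. E (u + v) = E u + E v" "\<And>c u. E (scale c u) = scale c (E u)"
    "\<And>u v. E (br u v) = br (E u) v + br u (E v) + scale (\<alpha> v) (\<delta> u) - scale (\<alpha> u) (\<delta> v)"
    "\<And>b. b \<in> B \<Longrightarrow> \<alpha> b = (if b = x then 1 else 0)" "\<And>b. b \<in> B \<Longrightarrow> \<delta> b = (if b = x then 0 else b)"
    "\<And>b. b \<in> B \<Longrightarrow> E b = 0"
proof -
  interpret lie_algebra scale br using assms by (simp add: free_lie_algebra_def)
  \<comment> \<open>The operators come from a homomorphism: z -> (z, \<delta> z, \<alpha> z, E z)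
    respects these operations exactly when \<delta>, \<alpha> and E obey the required rules, so the
    universal property yields all three at once.\<close>
  define scale' :: "'k \<Rightarrow> 'l \<times> 'l \<times> 'k \<times> 'l \<Rightarrow> 'l \<times> 'l \<times> 'k \<times> 'l" where
    "scale' = (\<lambda>c (a, d, \<alpha>, e). (scale c a, scale c d, c * \<alpha>, scale c e))"
  define br' :: "'l \<times> 'l \<times> 'k \<times> 'l \<Rightarrow> 'l \<times> 'l \<times> 'k \<times> 'l \<Rightarrow> 'l \<times> 'l \<times> 'k \<times> 'l" where
    "br' = (\<lambda>(a, d, \<alpha>, e) (a', d', \<alpha>', e').
       (br a a', br d a' + br a d', 0, br e a' + br a e' + scale \<alpha>' d - scale \<alpha> d'))"
  have "lie_algebra scale' br'"
  proof (unfold_locales, goal_cases)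
    case (10 X Y Z)
    obtain a d \<alpha> e where X: "X = (a, d, \<alpha>, e)" by (cases X) auto
    obtain a' d' \<alpha>' e' where Y: "Y = (a', d', \<alpha>', e')" by (cases Y) auto
    obtain a'' d'' \<alpha>'' e'' where Z: "Z = (a'', d'', \<alpha>'', e'')" by (cases Z) auto
    let ?J = "\<lambda>a b c. br a (br b c) + br b (br c a) + br c (br a b)"
    \<comment> \<open>The terms with a scalar coordinate cancel by antisymmetry; only Jacobi sums of
      \<open>br\<close> remain.\<close>
    have "br' X (br' Y Z) + br' Y (br' Z X) + br' Z (br' X Y) =
      (?J a a' a'', ?J d a' a'' + ?J a d' a'' + ?J a a' d'', 0, ?J e a' a'' + ?J a e' a'' + ?J a a' e'')"
      using br_antisym[of d a'] br_antisym[of d a''] br_antisym[of d' a] br_antisym[of d' a'']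
        br_antisym[of d'' a] br_antisym[of d'' a']
      by (simp add: X Y Z br'_def br_minus_left br_minus_right br_add_left br_add_right br_diff_left br_diff_right br_scale_left br_scale_right
          scale_right_distrib scale_right_diff_distrib algebra_simps)
    then show ?case by (simp add: jacobi zero_prod_def)
  next
    case (9 X)
    obtain a d \<alpha> e where X: "X = (a, d, \<alpha>, e)" by (cases X) auto
    show ?case
      using br_antisym[of d a] br_antisym[of e a] by (simp add: X br'_def br_self zero_prod_def)
  qed (auto simp: scale'_def br'_def br_add_left br_add_right br_scale_left br_scale_right br_self
      zero_prod_def algebra_simps scale_right_distrib scale_left_distrib scale_right_diff_distrib)
  then obtain h where h: "lie_hom scale br scale' br' h"
    and hB: "\<forall>b\<in>B. h b = (b, if b = x then 0 else b, if b = x then 1 else 0, 0)"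
    using free_lie_algebra_universal[OF assms, of scale' br' "\<lambda>b. (b, if b = x then 0 else b, if b = x then 1 else 0, 0)"]
    by blast
  have hom: "h (u + v) = h u + h v" "h (scale c u) = scale' c (h u)" "h (br u v) = br' (h u) (h v)" for u v c
    using h by (simp_all add: lie_hom_def)
  \<comment> \<open>The first component of \<open>h\<close> fixes the generators, hence is the
    identity. This turns the homomorphism laws of \<open>h\<close> into rules about
    \<open>br\<close> itself.\<close>
  have fst_h: "fst (h z) = z" for z
  proof (induction z rule: free_lie_algebra_induct[OF assms])
    case 2
    show ?case using hom(2)[of 0 0] by (simp add: scale'_def split: prod.splits)
  qed (auto simp: hB hom scale'_def br'_def split: prod.splits)
  show ?thesis
    by (rule that[of "\<lambda>z. fst (snd (snd (h z)))" "\<lambda>z. fst (snd (h z))" "\<lambda>z. snd (snd (snd (h z)))"])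
      (use fst_h in \<open>simp_all add: hom hB scale'_def br'_def split: prod.splits, (metis fst_conv)+\<close>)
qed

text \<open>Splitting off \<open>scale (\<alpha> z) x\<close> leaves a sum of \<delta>-eigenvectors
  with positive eigenvalues. Commuting with \<open>x\<close> makes a power of \<delta> kill this
  remainder, so it is zero.\<close>

theorem free_lie_algebra_centralizer_generator:
  fixes scale :: "'k::field_char_0 \<Rightarrow> 'l::ab_group_add \<Rightarrow> 'l"
  assumes free: "free_lie_algebra scale br B" and "x \<in> B" "br z x = 0"
  shows "\<exists>c. z = scale c x"
proof -
  interpret lie_algebra scale br using free by (simp add: free_lie_algebra_def)
  obtain \<alpha> \<delta> E where
    \<alpha>: "\<And>u v. \<alpha> (u + v) = \<alpha> u + \<alpha> v" "\<And>c u. \<alpha> (scale c u) = c * \<alpha> u" "\<And>u v. \<alpha> (br u v) = 0" and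
    \<delta>: "\<And>u v. \<delta> (u + v) = \<delta> u + \<delta> v" "\<And>c u. \<delta> (scale c u) = scale c (\<delta> u)"
      "\<And>u v. \<delta> (br u v) = br (\<delta> u) v + br u (\<delta> v)" and
    E: "\<And>u v. E (u + v) = E u + E v" "\<And>c u. E (scale c u) = scale c (E u)"
      "\<And>u v. E (br u v) = br (E u) v + br u (E v) + scale (\<alpha> v) (\<delta> u) - scale (\<alpha> u) (\<delta> v)" and
    B: "\<And>b. b \<in> B \<Longrightarrow> \<alpha> b = (if b = x then 1 else 0)" "\<And>b. b \<in> B \<Longrightarrow> \<delta> b = (if b = x then 0 else b)"
      "\<And>b. b \<in> B \<Longrightarrow> E b = 0"
    by (rule free_lie_algebra_lowering_operator[OF free, where x = x]) (rule that)
  have zero [simp]: "\<alpha> 0 = 0" "\<delta> 0 = 0" "E 0 = 0"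
    using \<alpha>(2)[of 0 0] \<delta>(2)[of 0 0] E(2)[of 0 0] by simp_all
  have diff: "\<delta> (u - v) = \<delta> u - \<delta> v" "E (u - v) = E u - E v" "\<alpha> (u - v) = \<alpha> u - \<alpha> v" for u v
    using \<delta>(1)[of "u - v" v] E(1)[of "u - v" v] \<alpha>(1)[of "u - v" v] by (simp_all add: algebra_simps)
  have \<alpha>\<delta>: "\<alpha> (\<delta> u) = 0" for u
    by (induction u rule: free_lie_algebra_induct[OF free]) (auto simp: \<alpha> \<delta> B)
  have \<alpha>E: "\<alpha> (E u) = 0" for u
    by (induction u rule: free_lie_algebra_induct[OF free]) (auto simp: \<alpha> E B diff \<alpha>\<delta>)
  have comm: "\<delta> (E u) = E (\<delta> u)" for u
    by (induction u rule: free_lie_algebra_induct[OF free]) (auto simp: \<delta> E B diff \<alpha>\<delta> \<alpha>E algebra_simps)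
  have En_add: "(E ^^ n) (u + v) = (E ^^ n) u + (E ^^ n) v" and En_diff: "(E ^^ n) (u - v) = (E ^^ n) u - (E ^^ n) v"
    and En_scale: "(E ^^ n) (scale c u) = scale c ((E ^^ n) u)" and En_zero: "(E ^^ n) 0 = 0"
    and En_\<delta>: "(E ^^ n) (\<delta> u) = \<delta> ((E ^^ n) u)" for n c u v
    by (induction n) (simp_all add: E diff comm)
  have En_mono: "(E ^^ n) u = 0" if "(E ^^ m) u = 0" "m \<le> n" for m n u
    using that(2,1) by (induction rule: dec_induct) simp_all
  \<comment> \<open>Induction on the total order m + n: one application of E gives two brackets of
    lower order and multiples of \<open>\<delta> u\<close> and \<open>\<delta> v\<close>. The
    remaining power of E kills these as well, because it commutes with \<delta> and its exponent is
    at least m and at least n.\<close>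
  have En_br: "(E ^^ (m + n)) (br u v) = 0" if "(E ^^ m) u = 0" "(E ^^ n) v = 0" for m n u v
    using that
  proof (induction "m + n" arbitrary: m n u v)
    case 0
    then show ?case by simp
  next
    case (Suc k)
    show ?case
    proof (cases "m = 0 \<or> n = 0")
      case True
      then show ?thesis using Suc.prems by (auto simp: En_zero)
    next
      case False
      then obtain m' n' where mn: "m = Suc m'" "n = Suc n'" by (meson not0_implies_Suc)
      have "(E ^^ (m' + n)) (br (E u) v) = 0" "(E ^^ (m + n')) (br u (E v)) = 0"
        using Suc.hyps(1)[of m' n "E u" v] Suc.hyps(1)[of m n' u "E v"] Suc.hyps(2) Suc.prems mn
        by (simp_all add: funpow_Suc_right del: funpow.simps(2))
      moreover have "(E ^^ (m' + n)) (\<delta> u) = 0" "(E ^^ (m' + n)) (\<delta> v) = 0"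
        using En_mono[OF Suc.prems(1), of "m' + n"] En_mono[OF Suc.prems(2), of "m' + n"] mn
        by (simp_all add: En_\<delta> del: funpow.simps)
      moreover have "m + n' = m' + n" using mn by simp
      moreover have "(E ^^ (m + n)) (br u v) = (E ^^ (m' + n)) (E (br u v))"
        using mn by (simp add: funpow_Suc_right del: funpow.simps(2))
      ultimately show ?thesis
        by (simp add: E(3) En_add En_diff En_scale)
    qed
  qed
  have nilp: "\<exists>n. (E ^^ n) u = 0" for u
  proof (induction u rule: free_lie_algebra_induct[OF free])
    case (1 b)
    then show ?case by (intro exI[of _ 1]) (simp add: B)
  next
    case 2
    then show ?case by (intro exI[of _ 0]) simp
  next
    case (3 u v)
    then obtain m n where "(E ^^ m) u = 0" "(E ^^ n) v = 0" by blast
    then have "(E ^^ max m n) (u + v) = 0"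
      using En_mono[of m u "max m n"] En_mono[of n v "max m n"] by (simp add: En_add)
    then show ?case by blast
  qed (auto simp: En_scale intro: En_br)
  \<comment> \<open>This iterates [E, ad x] = \<delta>. For \<open>n = 0\<close> the zero
    coefficient absorbs the truncated \<open>n - 1\<close>.\<close>
  have E_D: "(E ^^ n) (br u x) = br ((E ^^ n) u) x + scale (of_nat n) (\<delta> ((E ^^ (n - 1)) u))" for n u
  proof (induction n)
    case (Suc n)
    moreover have "scale 2 v = v + v" for v
      using scale_left_distrib[of 1 1 v] by simp
    ultimately show ?case
      by (cases n) (simp_all add: E B \<open>x \<in> B\<close> comm algebra_simps scale_left_distrib)
  qed simp
  \<comment> \<open>Applying \<open>E_D\<close> at n + 1 to a vanishing bracket gives (n + 1)
    \<delta> (E^n u) = 0. In characteristic zero E^n then kills \<open>\<delta> u\<close>, which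
    again commutes with \<open>x\<close>, so the induction continues with
    \<open>\<delta> u\<close>.\<close>
  have "(\<delta> ^^ n) u = 0" if "br u x = 0" "(E ^^ n) u = 0" for n u
    using that
  proof (induction n arbitrary: u)
    case (Suc n)
    have "\<delta> ((E ^^ n) u) = 0"
      using E_D[of "Suc n" u] Suc.prems En_zero[of "Suc n"] by (simp del: of_nat_Suc funpow.simps)
    then have "(E ^^ n) (\<delta> u) = 0" by (simp add: En_\<delta>)
    moreover have "br (\<delta> u) x = 0"
      using \<delta>(3)[of u x] Suc.prems(1) by (simp add: B \<open>x \<in> B\<close>)
    ultimately show ?case
      using Suc.IH by (simp add: funpow_Suc_right del: funpow.simps)
  qed simp
  then obtain n where "(\<delta> ^^ n) z = 0" using nilp assms(3) by blast
  \<comment> \<open>The exponent must be positive in order to kill \<open>x\<close> too, since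
    \<open>\<delta> x = 0\<close>.\<close>
  then have n: "(\<delta> ^^ Suc n) z = 0" by simp
  let ?u = "z - scale (\<alpha> z) x"
  have "(\<delta> ^^ k) (u - v) = (\<delta> ^^ k) u - (\<delta> ^^ k) v" for k u v
    by (induction k) (simp_all add: diff)
  moreover have "(\<delta> ^^ k) 0 = 0" for k
    by (induction k) simp_all
  ultimately have nilpotent: "(\<delta> ^^ Suc n) ?u = 0"
    using n by (simp add: funpow_Suc_right diff \<delta> B \<open>x \<in> B\<close> del: funpow.simps)
  define S where "S = {u. \<exists>n. \<delta> u = scale (of_nat (Suc n)) u}"
  have S_x: "br u x \<in> span S" if "u \<in> span S" for u
    using that
  proof (induction rule: span_induct)
    case base
    show ?case by (rule subspaceI) (auto simp: br_add_left br_scale_left span_zero span_add span_scale)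
  next
    case (step u)
    then show ?case unfolding S_def
      by (intro span_base) (auto simp: \<delta> B \<open>x \<in> B\<close> br_scale_left)
  qed
  have S_S: "br u v \<in> span S" if "u \<in> span S" "v \<in> span S" for u v
    using that(1)
  proof (induction rule: span_induct)
    case base
    show ?case by (rule subspaceI) (auto simp: br_add_left br_scale_left span_zero span_add span_scale)
  next
    case (step u)
    show ?case using that(2)
    proof (induction rule: span_induct)
      case base
      show ?case by (rule subspaceI) (auto simp: br_add_right br_scale_right span_zero span_add span_scale)
    next
      case (step v)
      obtain m n where "\<delta> u = scale (of_nat (Suc m)) u" "\<delta> v = scale (of_nat (Suc n)) v"
        using \<open>u \<in> S\<close> \<open>v \<in> S\<close> unfolding S_def by blast
      then have "\<delta> (br u v) = scale (of_nat (Suc m) + of_nat (Suc n)) (br u v)"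
        by (simp only: \<delta> br_scale_left br_scale_right scale_left_distrib)
      also have "of_nat (Suc m) + of_nat (Suc n) = (of_nat (Suc (Suc (m + n))) :: 'k)"
        by simp
      finally show ?case unfolding S_def by (intro span_base) blast
    qed
  qed
  \<comment> \<open>The algebra is K x plus \<open>span S\<close>. A bracket has no
    \<open>x\<close>-part because \<open>br x x = 0\<close>, which matches the vanishing of \<alpha>
    on brackets; the other contributions stay in \<open>span S\<close> by \<open>S_S\<close> and
    \<open>S_x\<close>.\<close>
  have decomp: "u - scale (\<alpha> u) x \<in> span S" for u
  proof (induction u rule: free_lie_algebra_induct[OF free])
    case (1 b)
    show ?case
    proof (cases "b = x")
      case False
      then have "\<delta> b = scale (of_nat (Suc 0)) b" using 1 B by simp
      then have "b \<in> S" unfolding S_def by blast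
      then show ?thesis using 1 False B by (simp add: span_base)
    qed (simp add: B \<open>x \<in> B\<close> span_zero)
  next
    case (3 u v)
    then show ?case using span_add[OF 3] by (simp add: \<alpha> scale_left_distrib algebra_simps)
  next
    case (4 c u)
    then show ?case using span_scale[OF 4, of c] by (simp add: \<alpha> scale_right_diff_distrib)
  next
    case (5 u v)
    define s where "s = u - scale (\<alpha> u) x"
    define t where "t = v - scale (\<alpha> v) x"
    have "br (s + scale (\<alpha> u) x) (t + scale (\<alpha> v) x) =
        br s t + scale (\<alpha> v) (br s x) - scale (\<alpha> u) (br t x)"
      using br_antisym[of x t]
      by (simp add: br_add_left br_add_right br_scale_left br_scale_right br_self algebra_simps)
    moreover have "br s t + scale (\<alpha> v) (br s x) - scale (\<alpha> u) (br t x) \<in> span S"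
      using 5 by (intro span_add span_diff span_scale S_S S_x) (simp_all add: s_def t_def)
    ultimately have "br u v \<in> span S" by (simp add: s_def t_def)
    then show ?case by (simp add: \<alpha>)
  qed (simp add: span_zero)
  have "?u = 0"
  proof (rule span_eigenvectors_nilpotent[where \<delta> = \<delta> and k = "Suc n"])
    show "?u \<in> span {u. \<exists>n. \<delta> u = scale (of_nat (Suc n)) u}"
      using decomp unfolding S_def .
  qed (fact vector_space_axioms \<delta>(1,2) nilpotent)+
  then show ?thesis by (auto simp: algebra_simps)
qed

section \<open>Defining the integer multiples of a generator\<close>

text \<open>
  The semidirect product of \<open>K x\<close> with a two-step nilpotent algebra, spanned by the elements
  \<open>y f(ad x)\<close> and \<open>w g(-ad x)\<close>, where \<open>ad x\<close> acts from the right, and by their brackets. The latter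
  are polynomials in two commuting variables \<open>s, t\<close> modulo \<open>(s + t)\<^sup>2\<close>, written
  \<open>F(s) + (s + t) G(s)\<close>. The derivative in the bracket comes from \<open>g(-t) = g(s) - (s + t) g'(s)\<close>.
\<close>

type_synonym 'k model = "'k \<times> 'k poly \<times> 'k poly \<times> 'k poly \<times> 'k poly"

fun model_scale :: "'k::field \<Rightarrow> 'k model \<Rightarrow> 'k model" where
  "model_scale c (a, f, g, F, G) = (c * a, smult c f, smult c g, smult c F, smult c G)"

fun model_br :: "'k::field model \<Rightarrow> 'k model \<Rightarrow> 'k model" where
  "model_br (a, f, g, F, G) (a', f', g', F', G') =
     (0, [:0, 1:] * (smult a' f - smult a f'), - [:0, 1:] * (smult a' g - smult a g'),
      f * g' - f' * g, f' * pderiv g - f * pderiv g' + smult a' F - smult a F')"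

lemma lie_algebra_model: "lie_algebra model_scale model_br"
proof (unfold_locales, goal_cases)
  case (10 X Y Z)
  show ?case
    by (cases X, cases Y, cases Z)
      (simp add: zero_prod_def pderiv_mult pderiv_diff pderiv_smult pderiv_pCons pderiv_minus algebra_simps smult_diff_right smult_add_right)
qed (auto simp: zero_prod_def pderiv_add pderiv_smult algebra_simps smult_add_left smult_add_right smult_diff_right)

text \<open>The Euler operator s d/ds multiplies s^n by n, so comparing leading coefficients
  determines the eigenvalue.\<close>

lemma euler_operator_eigenvalue:
  fixes f :: "'k::field_char_0 poly"
  assumes "[:0, 1:] * pderiv f = smult c f" "f \<noteq> 0"
  shows "c = of_nat (degree f)"
proof -
  have "coeff ([:0, 1:] * pderiv f) (degree f) = of_nat (degree f) * lead_coeff f"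
    by (cases "degree f") (simp_all add: coeff_pderiv)
  then show ?thesis using assms by simp
qed

section \<open>Natural scalars as solvability of a system\<close>

lemma free_lie_algebra_model_hom:
  fixes scale :: "'k::field \<Rightarrow> 'l::ab_group_add \<Rightarrow> 'l"
  assumes "free_lie_algebra scale br B" "{x, y, w} \<subseteq> B" "distinct [x, y, w]"
  obtains h where "lie_hom scale br model_scale model_br h"
    "h x = (1, 0, 0, 0, 0)" "h y = (0, 1, 0, 0, 0)" "h w = (0, 0, 1, 0, 0)"
proof -
  \<comment> \<open>The values at further generators are free; the last case serves them and
    \<open>w\<close> alike.\<close>
  define f :: "'l \<Rightarrow> 'k model" where
    "f b = (if b = x then (1, 0, 0, 0, 0) else if b = y then (0, 1, 0, 0, 0) else (0, 0, 1, 0, 0))" for b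
  obtain h where "lie_hom scale br model_scale model_br h" "\<forall>b\<in>B. h b = f b"
    using free_lie_algebra_universal[OF assms(1) lie_algebra_model, of f] by blast
  then show ?thesis
    using assms(2,3) by (intro that[of h]) (auto simp: f_def)
qed

text \<open>The scalar can be read off from the first coordinate of the model, where
  \<open>x\<close> becomes 1.\<close>

lemma scale_generator_eq_iff:
  fixes scale :: "'k::field \<Rightarrow> 'l::ab_group_add \<Rightarrow> 'l"
  assumes "free_lie_algebra scale br B" "{x, y, w} \<subseteq> B" "distinct [x, y, w]"
  shows "scale c x = scale d x \<longleftrightarrow> c = d"
proof -
  obtain h where "lie_hom scale br model_scale model_br h" "h x = (1, 0, 0, 0, 0)"
    by (rule free_lie_algebra_model_hom[OF assms])
  then have "h (scale c x) = (c, 0, 0, 0, 0)" for c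
    by (simp add: lie_hom_def)
  then show ?thesis by (metis fst_conv)
qed

lemma natural_scalar_if_solvable:
  fixes scale :: "'k::field_char_0 \<Rightarrow> 'l::ab_group_add \<Rightarrow> 'l"
  assumes "free_lie_algebra scale br B" "{x, y, w} \<subseteq> B" "distinct [x, y, w]"
    and "br p w = br y q + br (br r w + br v x) x" "br (scale c x) p = br x (br r x)"
      "p + g = y + br g x"
  shows "\<exists>n. c = of_nat n"
proof -
  obtain h where h: "lie_hom scale br model_scale model_br h"
    "h x = (1, 0, 0, 0, 0)" "h y = (0, 1, 0, 0, 0)" "h w = (0, 0, 1, 0, 0)"
    by (rule free_lie_algebra_model_hom[OF assms(1-3)])
  have hom: "h (a + b) = h a + h b" "h (scale e a) = model_scale e (h a)"
    "h (br a b) = model_br (h a) (h b)" for a b e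
    using h(1) by (simp_all add: lie_hom_def)
  obtain p0 P p2 p3 p4 where p: "h p = (p0, P, p2, p3, p4)" by (cases "h p")
  obtain q0 q1 Q q3 q4 where q: "h q = (q0, q1, Q, q3, q4)" by (cases "h q")
  obtain r0 R r2 r3 r4 where r: "h r = (r0, R, r2, r3, r4)" by (cases "h r")
  obtain v0 v1 v2 v3 v4 where v: "h v = (v0, v1, v2, v3, v4)" by (cases "h v")
  obtain g0 G g2 g3 g4 where g: "h g = (g0, G, g2, g3, g4)" by (cases "h g")
  \<comment> \<open>The F coordinates give the first equation, the G coordinates the second. The
    summand with \<open>v\<close> contributes nothing to them, as two brackets with \<open>x\<close>
    multiply by (s + t)^2.\<close>
  have "P = Q" "R = pderiv Q"
    using arg_cong[OF assms(4), of h] by (auto simp: hom h p q r v algebra_simps)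
  \<comment> \<open>This compares the coordinates of y f(ad x), with a common factor s
    cancelled.\<close>
  moreover have "- ([:0, 1:] * R) = - smult c P"
    using arg_cong[OF assms(5), of h] by (simp add: hom h p r)
  then have "[:0, 1:] * R = smult c P"
    by (simp only: neg_equal_iff_equal)
  ultimately have "[:0, 1:] * pderiv P = smult c P" by simp
  moreover have "P + G = 1 + [:0, 1:] * G"
    using arg_cong[OF assms(6), of h] by (simp add: hom h p g)
  \<comment> \<open>At 1 the contributions of \<open>G\<close> cancel and P(1) = 1 remains, so
    \<open>P\<close> is a genuine eigenvector of the Euler operator.\<close>
  then have "poly (P + G) 1 = poly (1 + [:0, 1:] * G) 1" by simp
  then have "P \<noteq> 0" by auto
  ultimately show ?thesis using euler_operator_eigenvalue by blast
qed

lemma (in lie_algebra) solvable_if_natural_scalar: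
  "\<exists>p q r v g. br p w = br y q + br (br r w + br v x) x \<and>
     br (scale (of_nat n) x) p = br x (br r x) \<and> p + g = y + br g x"
proof -
  let ?D = "\<lambda>z. br z x"
  obtain v where v: "br ((?D ^^ n) y) w = scale ((-1) ^ n) (br y ((?D ^^ n) w)) +
      ?D (scale (of_nat n) (br ((?D ^^ (n - 1)) y) w) + ?D v)"
    using br_funpow_expansion by blast
  \<comment> \<open>In polynomials: p = s^n, q = (-t)^n, r = n s^(n-1) = p', and g = 1 + s + ... +
    s^(n-1), so that (1 - s) g = 1 - p.\<close>
  define p where "p = (?D ^^ n) y"
  define q where "q = scale ((-1) ^ n) ((?D ^^ n) w)"
  define r where "r = scale (of_nat n) ((?D ^^ (n - 1)) y)"
  define g where "g = (\<Sum>i<n. (?D ^^ i) y)"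
  have "br p w = br y q + br (br r w + br v x) x"
    using v by (simp add: p_def q_def r_def br_scale_left br_scale_right)
  moreover have "br r x = scale (of_nat n) p"
    by (cases n) (simp_all add: r_def p_def br_scale_left)
  then have "br (scale (of_nat n) x) p = br x (br r x)"
    by (simp add: br_scale_left br_scale_right)
  moreover have "p + g = y + br g x"
  proof -
    have "br g x = (\<Sum>i<n. (?D ^^ Suc i) y)"
      by (simp add: g_def br_sum_left)
    then show ?thesis
      using sum.lessThan_Suc[of "\<lambda>i. (?D ^^ i) y" n] sum.lessThan_Suc_shift[of "\<lambda>i. (?D ^^ i) y" n]
      by (simp add: g_def p_def add.commute)
  qed
  ultimately show ?thesis by blast
qed

lemma natural_multiples_definable:
  fixes scale :: "'k::field_char_0 \<Rightarrow> 'l::ab_group_add \<Rightarrow> 'l"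
  assumes free: "free_lie_algebra scale br B" and xyw: "{x, y, w} \<subseteq> B" "distinct [x, y, w]"
  shows "e_definable scale br 1 (range (\<lambda>n. [scale (of_nat n) x]))"
proof -
  interpret lie_algebra scale br using free by (simp add: free_lie_algebra_def)
  let ?U = "\<lambda>i. Gen (Unknown i) :: ('k, 'l eq_symbol) lie_term"
    and ?C = "\<lambda>c. Gen (Coeff c) :: ('k, 'l eq_symbol) lie_term"
  \<comment> \<open>Unknown 0 is the candidate z; unknowns 1 to 5 are p, q, r, v, g. By the
    centralizer theorem the first equation makes z a scalar multiple of \<open>x\<close>; the others
    then force the scalar to be natural.\<close>
  let ?\<Sigma> = "{(Br (?U 0) (?C x), Zero),
    (Br (?U 1) (?C w), Add (Br (?C y) (?U 2)) (Br (Add (Br (?U 3) (?C w)) (Br (?U 4) (?C x))) (?C x))),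
    (Br (?U 0) (?U 1), Br (?C x) (Br (?U 3) (?C x))),
    (Add (?U 1) (?U 5), Add (?C y) (Br (?U 5) (?C x)))}"
  have sol: "(\<forall>e\<in>?\<Sigma>. eq_solution scale br ([z] @ [p, q, r, v, g]) e) \<longleftrightarrow> br z x = 0 \<and>
      br p w = br y q + br (br r w + br v x) x \<and> br z p = br x (br r x) \<and> p + g = y + br g x"
    for z p q r v g
    by (simp add: eq_solution_def numeral_eq_Suc)
  show ?thesis
  proof (rule e_definableI[where \<Sigma> = ?\<Sigma> and k = 5])
    show "eq_unknowns e \<subseteq> {..<1 + 5}" if "e \<in> ?\<Sigma>" for e
      using that by (auto simp: eq_unknowns_def)
    fix xs
    show "xs \<in> range (\<lambda>n. [scale (of_nat n) x]) \<longleftrightarrow> length xs = 1 \<and>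
        (\<exists>ys. length ys = 5 \<and> (\<forall>e\<in>?\<Sigma>. eq_solution scale br (xs @ ys) e))"
    proof
      assume "xs \<in> range (\<lambda>n. [scale (of_nat n) x])"
      then obtain n where xs: "xs = [scale (of_nat n) x]" by blast
      obtain p q r v g where "br p w = br y q + br (br r w + br v x) x"
        "br (scale (of_nat n) x) p = br x (br r x)" "p + g = y + br g x"
        using solvable_if_natural_scalar by blast
      then have "\<forall>e\<in>?\<Sigma>. eq_solution scale br ([scale (of_nat n) x] @ [p, q, r, v, g]) e"
        unfolding sol by (simp add: br_scale_left br_self)
      then show "length xs = 1 \<and>
        (\<exists>ys. length ys = 5 \<and> (\<forall>e\<in>?\<Sigma>. eq_solution scale br (xs @ ys) e))"
        unfolding xs by (intro conjI exI[of _ "[p, q, r, v, g]"]) simp_all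
    next
      assume "length xs = 1 \<and>
        (\<exists>ys. length ys = 5 \<and> (\<forall>e\<in>?\<Sigma>. eq_solution scale br (xs @ ys) e))"
      then obtain ys where ys: "length xs = 1" "length ys = 5"
        "\<forall>e\<in>?\<Sigma>. eq_solution scale br (xs @ ys) e" by blast
      obtain z where xs: "xs = [z]"
        using ys(1) by (auto simp: length_Suc_conv)
      obtain p q r v g where "ys = [p, q, r, v, g]"
        using ys(2) by (auto simp: numeral_eq_Suc length_Suc_conv)
      with ys(3) have *: "br z x = 0" "br p w = br y q + br (br r w + br v x) x"
          "br z p = br x (br r x)" "p + g = y + br g x"
        unfolding xs sol[symmetric] using sol by blast+
      obtain c where c: "z = scale c x"
        using free_lie_algebra_centralizer_generator[OF free _ *(1)] xyw(1) by auto
      then show "xs \<in> range (\<lambda>n. [scale (of_nat n) x])"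
        using natural_scalar_if_solvable[OF free xyw *(2) *(3)[unfolded c] *(4)] xs by auto
    qed
  qed simp
qed

section \<open>From natural multiples to the ring of integers\<close>

lemma e_definable_component:
  assumes "e_definable scale br 1 X" "i < m"
  shows "e_definable scale br m {xs. length xs = m \<and> [xs ! i] \<in> X}"
  using e_definable_subst[OF assms(1), of "[Gen (Unknown i)]" m] assms(2) by simp

text \<open>Integers are differences of natural numbers: z + n x = m x is imposed with two natural
  multiples, which are then projected away.\<close>

lemma integer_multiples_definable:
  fixes scale :: "'k::field_char_0 \<Rightarrow> 'l::ab_group_add \<Rightarrow> 'l"
  assumes "free_lie_algebra scale br B" "{x, y, w} \<subseteq> B" "distinct [x, y, w]"
  shows "e_definable scale br 1 (range (\<lambda>k::int. [scale (of_int k) x]))"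
proof -
  interpret lie_algebra scale br using assms by (simp add: free_lie_algebra_def)
  let ?N = "range (\<lambda>n. [scale (of_nat n) x])"
  let ?W = "{xs. length xs = 1 + 2 \<and> [xs ! 1] \<in> ?N} \<inter> {xs. length xs = 1 + 2 \<and> [xs ! 2] \<in> ?N} \<inter>
    {xs. length xs = 1 + 2 \<and> eq_solution scale br xs
      (Add (Gen (Unknown 0)) (Gen (Unknown 2)), Gen (Unknown 1))}"
  have "e_definable scale br (1 + 2) ?W"
    by (intro e_definable_Int e_definable_component natural_multiples_definable[OF assms]
        e_definable_equation) (auto simp: eq_unknowns_def)
  then have "e_definable scale br 1 {xs. length xs = 1 \<and> (\<exists>ys. length ys = 2 \<and> xs @ ys \<in> ?W)}"
    by (rule e_definable_exists)
  also have "{xs. length xs = 1 \<and> (\<exists>ys. length ys = 2 \<and> xs @ ys \<in> ?W)} =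
    range (\<lambda>k::int. [scale (of_int k) x])" (is "?L = ?R")
  proof
    show "?L \<subseteq> ?R"
    proof
      fix xs assume "xs \<in> ?L"
      then obtain ys where ys: "length xs = 1" "length ys = 2" "xs @ ys \<in> ?W" by blast
      obtain z where z: "xs = [z]"
        using ys(1) by (auto simp: length_Suc_conv)
      obtain a b where "ys = [a, b]"
        using ys(2) by (auto simp: numeral_eq_Suc length_Suc_conv)
      then obtain m n where "z + scale (of_nat n) x = scale (of_nat m) x"
        using ys(3) by (auto simp: z eq_solution_def numeral_eq_Suc)
      then have "z = scale (of_int (int m - int n)) x"
        by (simp add: scale_left_diff_distrib algebra_simps)
      then show "xs \<in> ?R" unfolding z by blast
    qed
    show "?R \<subseteq> ?L"
    proof
      fix xs assume "xs \<in> ?R"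
      then obtain k where k: "xs = [scale (of_int k) x]" by blast
      obtain m n where mn: "k = int m - int n" by (metis int_diff_cases)
      have "[scale (of_int k) x] @ [scale (of_nat m) x, scale (of_nat n) x] \<in> ?W"
        by (auto simp: eq_solution_def numeral_eq_Suc mn scale_left_diff_distrib)
      then show "xs \<in> ?L"
        unfolding k by (intro CollectI conjI exI[of _ "[scale (of_nat m) x, scale (of_nat n) x]"]) simp_all
    qed
  qed
  finally show ?thesis .
qed

text \<open>As \<phi> inverts the coding k -> \<open>[e k]\<close>, every element has exactly one
  code. This reduces each preimage in the interpretation to an explicit set of tuples.\<close>

lemma rel_preimage_singletons:
  assumes "\<And>k. \<phi> [e k] = k" "\<And>ks. ks \<in> R \<Longrightarrow> length ks = n"
  shows "rel_preimage (range (\<lambda>k. [e k])) \<phi> n R = map e ` R"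
proof
  show "rel_preimage (range (\<lambda>k. [e k])) \<phi> n R \<subseteq> map e ` R"
  proof
    fix zs assume "zs \<in> rel_preimage (range (\<lambda>k. [e k])) \<phi> n R"
    then obtain xss where xss: "zs = concat xss" "set xss \<subseteq> range (\<lambda>k. [e k])" "map \<phi> xss \<in> R"
      unfolding rel_preimage_def by blast
    from xss(2) have "concat xss = map e (map \<phi> xss)"
      by (induction xss) (auto simp: assms(1))
    then show "zs \<in> map e ` R" using xss by blast
  qed
  show "map e ` R \<subseteq> rel_preimage (range (\<lambda>k. [e k])) \<phi> n R"
  proof
    fix zs assume "zs \<in> map e ` R"
    then obtain ks where ks: "ks \<in> R" "zs = map e ks" by blast
    have "zs = concat (map (\<lambda>k. [e k]) ks)" unfolding ks(2) by (induction ks) auto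
    moreover have "map \<phi> (map (\<lambda>k. [e k]) ks) \<in> R"
      using ks(1) by (simp add: assms(1) comp_def)
    ultimately show "zs \<in> rel_preimage (range (\<lambda>k. [e k])) \<phi> n R"
      unfolding rel_preimage_def using assms(2)[OF ks(1)]
      by (intro CollectI exI[of _ "map (\<lambda>k. [e k]) ks"]) auto
  qed
qed

text \<open>The element u carries b over from \<open>x\<close> to \<open>y\<close>: the first
  equation fixes u as b y up to the centralizer of \<open>x\<close>, and bracketing with a x then
  produces a b. That c is forced is read off in the model from the coordinates of y f(ad x).\<close>

lemma scalar_product_iff:
  fixes scale :: "'k::field \<Rightarrow> 'l::ab_group_add \<Rightarrow> 'l"
  assumes "free_lie_algebra scale br B" "{x, y, w} \<subseteq> B" "distinct [x, y, w]"
  shows "(\<exists>u. br (scale b x) y = br x u \<and> br (scale a x) u = br (scale c x) y) \<longleftrightarrow> c = a * b"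
proof
  interpret lie_algebra scale br using assms by (simp add: free_lie_algebra_def)
  show "\<exists>u. br (scale b x) y = br x u \<and> br (scale a x) u = br (scale c x) y" if "c = a * b"
    using that by (intro exI[of _ "scale b y"]) (simp add: br_scale_left br_scale_right)
  assume "\<exists>u. br (scale b x) y = br x u \<and> br (scale a x) u = br (scale c x) y"
  then obtain u where u: "br (scale b x) y = br x u" "br (scale a x) u = br (scale c x) y" by blast
  obtain h where h: "lie_hom scale br model_scale model_br h"
    "h x = (1, 0, 0, 0, 0)" "h y = (0, 1, 0, 0, 0)"
    by (rule free_lie_algebra_model_hom[OF assms])
  have hom: "h (scale e v) = model_scale e (h v)" "h (br v v') = model_br (h v) (h v')" for e v v'
    using h(1) by (simp_all add: lie_hom_def)
  obtain u0 U u2 u3 u4 where hu: "h u = (u0, U, u2, u3, u4)" by (cases "h u")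
  have "- [:b:] = - U" "- smult a U = - [:c:]"
    using arg_cong[OF u(1), of h] arg_cong[OF u(2), of h] by (simp_all add: hom h hu)
  then have "U = [:b:]" "smult a U = [:c:]" by (simp_all only: neg_equal_iff_equal)
  then show "c = a * b" by simp
qed

theorem theorem4:
  fixes scale :: "'k::field_char_0 \<Rightarrow> 'l::ab_group_add \<Rightarrow> 'l"
    and br :: "'l \<Rightarrow> 'l \<Rightarrow> 'l"
    and B :: "'l set"
  assumes "free_lie_algebra scale br B"
    and "infinite B \<or> card B > 2"
  shows "e_interpretable scale br int_ring"
proof -
  interpret lie_algebra scale br using assms(1) by (simp add: free_lie_algebra_def)
  obtain S where "S \<subseteq> B" "card S = 3"
    using assms(2) infinite_arbitrarily_large[of B 3] obtain_subset_with_card_n[of 3 B] by force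
  then obtain x y w where xyw: "{x, y, w} \<subseteq> B" "distinct [x, y, w]"
    by (auto simp: card_3_iff)
  note free = assms(1) xyw
  define e where "e k = scale (of_int k) x" for k :: int
  have e_eq: "e k = e l \<longleftrightarrow> k = l" for k l
    unfolding e_def scale_generator_eq_iff[OF free] by simp
  define X where "X = range (\<lambda>k. [e k])"
  \<comment> \<open>Injectivity of \<open>e\<close> makes this description well defined on
    \<open>X\<close>; outside \<open>X\<close> the value is left unspecified.\<close>
  define \<phi> where "\<phi> zs = (THE k. zs = [e k])" for zs
  have \<phi>: "\<phi> [e k] = k" for k
    unfolding \<phi>_def by (rule the_equality) (auto simp: e_eq)
  have X: "e_definable scale br 1 X"
    using integer_multiples_definable[OF free] by (simp add: X_def e_def)
  have X_component: "e_definable scale br m {zs. length zs = m \<and> [zs ! i] \<in> X}" if "i < m" for i m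
    using e_definable_component[OF X that] .
  have pre: "rel_preimage X \<phi> n R = map e ` R" if "\<And>ks. ks \<in> R \<Longrightarrow> length ks = n" for n R
    unfolding X_def using \<phi> that by (rule rel_preimage_singletons)
  let ?U = "\<lambda>i. Gen (Unknown i) :: ('k, 'l eq_symbol) lie_term"
    and ?C = "\<lambda>c. Gen (Coeff c) :: ('k, 'l eq_symbol) lie_term"
  have equality: "e_definable scale br 2 (map e ` {[a, a] | a. a \<in> UNIV})"
  proof -
    have "e_definable scale br 2 ({zs. length zs = 2 \<and> [zs ! 0] \<in> X} \<inter>
        {zs. length zs = 2 \<and> eq_solution scale br zs (?U 0, ?U 1)})"
      by (intro e_definable_Int X_component e_definable_equation) (auto simp: eq_unknowns_def)
    also have "\<dots> = range (\<lambda>a. [e a, e a])"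
      by (auto simp: X_def eq_solution_def numeral_eq_Suc length_Suc_conv)
    also have "\<dots> = map e ` {[a, a] | a. a \<in> UNIV}"
      by (simp add: full_SetCompr_eq image_image)
    finally show ?thesis .
  qed
  have graph: "map e ` {as @ [f as] | as. length as = 2 \<and> set as \<subseteq> UNIV} =
      {[e a, e b, e (f [a, b])] | a b. True}" (is "?L = ?R") for f
  proof
    show "?L \<subseteq> ?R" by (auto simp: e_eq numeral_eq_Suc length_Suc_conv)
    show "?R \<subseteq> ?L"
    proof
      fix zs assume "zs \<in> ?R"
      then obtain a b where "zs = [e a, e b, e (f [a, b])]" by blast
      then have "zs = map e ([a, b] @ [f [a, b]])" by simp
      moreover have "length [a, b] = 2" by simp
      ultimately show "zs \<in> ?L" by blast
    qed
  qed
  have addition: "e_definable scale br 3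
      (map e ` {as @ [as ! 0 + as ! 1] | as. length as = 2 \<and> set as \<subseteq> UNIV})"
  proof -
    have "e_definable scale br 3 ({zs. length zs = 3 \<and> [zs ! 0] \<in> X} \<inter>
        {zs. length zs = 3 \<and> [zs ! 1] \<in> X} \<inter>
        {zs. length zs = 3 \<and> eq_solution scale br zs (Add (?U 0) (?U 1), ?U 2)})"
      by (intro e_definable_Int X_component e_definable_equation) (auto simp: eq_unknowns_def)
    also have "\<dots> = {[e a, e b, e a + e b] | a b. True}"
      by (auto simp: X_def e_eq eq_solution_def numeral_eq_Suc length_Suc_conv)
    also have "\<dots> = {[e a, e b, e (a + b)] | a b. True}"
      by (simp add: e_def scale_left_distrib)
    also have "\<dots> = map e ` {as @ [as ! 0 + as ! 1] | as. length as = 2 \<and> set as \<subseteq> UNIV}"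
      unfolding graph by simp
    finally show ?thesis .
  qed
  have multiplication: "e_definable scale br 3
      (map e ` {as @ [as ! 0 * as ! 1] | as. length as = 2 \<and> set as \<subseteq> UNIV})"
  proof -
    let ?P = "{zs. length zs = 3 \<and> (\<exists>u. br (zs ! 1) y = br x u \<and> br (zs ! 0) u = br (zs ! 2) y)}"
    \<comment> \<open>Unknowns 0 and 1 are the factors, unknown 2 the product and unknown 3 the
      auxiliary u. The equations speak of arbitrary elements; the intersection with the conditions
      on \<open>X\<close> turns them into a product of integers.\<close>
    let ?\<Sigma> = "{(Br (?U 1) (?C y), Br (?C x) (?U 3)), (Br (?U 0) (?U 3), Br (?U 2) (?C y))}"
    have sol: "(\<forall>e\<in>?\<Sigma>. eq_solution scale br (zs @ [u]) e) \<longleftrightarrow>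
        br (zs ! 1) y = br x u \<and> br (zs ! 0) u = br (zs ! 2) y" if "length zs = 3" for zs u
      using that by (simp add: eq_solution_def nth_append)
    have "e_definable scale br 3 ?P"
    proof (rule e_definableI[where \<Sigma> = ?\<Sigma> and k = 1])
      show "eq_unknowns e \<subseteq> {..<3 + 1}" if "e \<in> ?\<Sigma>" for e
        using that by (auto simp: eq_unknowns_def)
      show "zs \<in> ?P \<longleftrightarrow> length zs = 3 \<and>
          (\<exists>us. length us = 1 \<and> (\<forall>e\<in>?\<Sigma>. eq_solution scale br (zs @ us) e))" for zs
      proof (cases "length zs = 3")
        case True
        have "(\<exists>us. length us = 1 \<and> (\<forall>e\<in>?\<Sigma>. eq_solution scale br (zs @ us) e)) \<longleftrightarrow>
            (\<exists>u. \<forall>e\<in>?\<Sigma>. eq_solution scale br (zs @ [u]) e)"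
          (is "?l \<longleftrightarrow> ?r")
        proof
          assume ?l
          then obtain us where "length us = 1" "\<forall>e\<in>?\<Sigma>. eq_solution scale br (zs @ us) e" by blast
          moreover from this(1) obtain u where "us = [u]" by (auto simp: length_Suc_conv)
          ultimately show ?r by blast
        next
          assume ?r
          then obtain u where "\<forall>e\<in>?\<Sigma>. eq_solution scale br (zs @ [u]) e" by blast
          then show ?l by (intro exI[of _ "[u]"] conjI) simp_all
        qed
        then show ?thesis using True unfolding sol[OF True] by simp
      qed simp
    qed simp
    then have "e_definable scale br 3 ({zs. length zs = 3 \<and> [zs ! 0] \<in> X} \<inter>
        {zs. length zs = 3 \<and> [zs ! 1] \<in> X} \<inter> {zs. length zs = 3 \<and> [zs ! 2] \<in> X} \<inter> ?P)"
      by (intro e_definable_Int X_component) simp_all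
    also have "\<dots> = {[e a, e b, e c] | a b c.
        \<exists>u. br (e b) y = br x u \<and> br (e a) u = br (e c) y}"
      by (auto simp: X_def e_eq numeral_eq_Suc length_Suc_conv)
    also have "\<dots> = {[e a, e b, e (a * b)] | a b. True}"
      unfolding e_def scalar_product_iff[OF free] of_int_mult[symmetric] of_int_eq_iff by simp
    also have "\<dots> = map e ` {as @ [as ! 0 * as ! 1] | as. length as = 2 \<and> set as \<subseteq> UNIV}"
      unfolding graph by simp
    finally show ?thesis .
  qed
  have constant_definable: "e_definable scale br 1 (map e ` {[k]})" for k
  proof -
    have "e_definable scale br 1 {zs. length zs = 1 \<and> eq_solution scale br zs (?U 0, ?C (e k))}"
      by (rule e_definable_equation) (auto simp: eq_unknowns_def)
    also have "\<dots> = map e ` {[k]}"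
      by (auto simp: eq_solution_def length_Suc_conv)
    finally show ?thesis .
  qed
  have "e_interpretation scale br int_ring 1 X \<phi>"
    unfolding e_interpretation_def
  proof (intro conjI)
    show "\<phi> ` X = universe int_ring"
      by (auto simp: X_def int_ring_def image_image \<phi>)
    show "e_definable scale br (2 * 1) (rel_preimage X \<phi> 2 {[a, a] | a. a \<in> universe int_ring})"
      using equality by (subst pre) (auto simp: int_ring_def)
    show "\<forall>(n, f)\<in>operations int_ring. e_definable scale br ((n + 1) * 1)
        (rel_preimage X \<phi> (n + 1) {as @ [f as] | as. length as = n \<and> set as \<subseteq> universe int_ring})"
    proof (safe)
      fix n f assume "(n, f) \<in> operations int_ring"
      then have n: "n = 2" and f: "f = (\<lambda>as. as ! 0 + as ! 1) \<or> f = (\<lambda>as. as ! 0 * as ! 1)"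
        by (auto simp: int_ring_def)
      then show "e_definable scale br ((n + 1) * 1)
        (rel_preimage X \<phi> (n + 1) {as @ [f as] | as. length as = n \<and> set as \<subseteq> universe int_ring})"
        using addition multiplication unfolding n by (subst pre) (auto simp: int_ring_def)
    qed
    show "\<forall>c\<in>constants int_ring. e_definable scale br 1 (rel_preimage X \<phi> 1 {[c]})"
      using constant_definable by (subst pre) auto
    show "\<forall>(n, R)\<in>predicates int_ring. e_definable scale br (n * 1) (rel_preimage X \<phi> n R)"
      by (simp add: int_ring_def)
  qed (rule X)
  then show ?thesis unfolding e_interpretable_def by blast
qed

end
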